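(* Let $\Lambda=\mathbb{Z}\omega_1+\mathbb{Z}\omega_2\subset\mathbb{C}$ be a lattice ($\omega_1,\omega_2\ne0$, $\omega_1/\omega_2\notin\mathbb{R}$), let $\wp(z)=\wp(z;\Lambda)$, and let $G$ be the wallpaper group p2 realised as the group generated by the translations $z\mapsto z+\omega$ ($\omega\in\Lambda$) and the rotation $z\mapsto -z$. Then the meromorphic functions $f:\mathbb{C}\to\mathbb{CP}^1$ that are $G$-invariant are exactly the functions of the form $f(z)=R(\wp(z))$ with $R$ a rational function with complex coefficients.
   Context: $f$ is $G$-invariant if $f(g.z)=f(z)$ for all $g\in G$ and $z\in\mathbb{C}$. The Weierstrass function of a lattice $\Lambda$ is $\wp(z;\Lambda)=\frac1{z^2}+\sum_{\omega\in\Lambda\setminus\{0\}}\left(\frac1{(z-\omega)^2}-\frac1{\omega^2}\right)$. *)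

theory Defs
  imports
    "HOL-Complex_Analysis.Complex_Analysis"
    "HOL-Computational_Algebra.Polynomial_Factorial"
    "HOL-Algebra.Bij"
    "HOL-Algebra.Generated_Groups"
begin

(* The complex projective line as the Riemann sphere: CP_fin w is the point [w : 1] and
   CP_inf the point [1 : 0]. *)
datatype cp1 = CP_fin complex | CP_inf

(* A meromorphic function with values in the sphere is infinite exactly at its poles.  The
   library's meromorphic functions are complex-valued; "nicely" says that removable singularities
   are removed (and fixes the value 0 at poles, which is overwritten here).  The constant infinity
   is not a meromorphic function. *)
definition meromorphic_to_cp1 :: "(complex \<Rightarrow> cp1) \<Rightarrow> bool" where
  "meromorphic_to_cp1 f \<longleftrightarrow>
     (\<exists>g. g nicely_meromorphic_on UNIV \<and>
          f = (\<lambda>z. if is_pole g z then CP_inf else CP_fin (g z)))"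

(* The self-map of the sphere induced by p / q, for coprime p and q with q nonzero;
   the value at infinity is the limit of p(w) / q(w) as w tends to infinity. *)
fun ratfun_cp1 :: "complex poly \<Rightarrow> complex poly \<Rightarrow> cp1 \<Rightarrow> cp1" where
  "ratfun_cp1 p q (CP_fin w) =
     (if poly q w = 0 then CP_inf else CP_fin (poly p w / poly q w))"
| "ratfun_cp1 p q CP_inf =
     (if degree p > degree q then CP_inf else CP_fin (coeff p (degree q) / lead_coeff q))"

(* Every quotient of polynomials has a representation in lowest terms, so coprimality is no
   restriction; it is what makes the pointwise formula above correct at common zeros. *)
definition rational_function :: "(cp1 \<Rightarrow> cp1) \<Rightarrow> bool" where
  "rational_function R \<longleftrightarrow> (\<exists>p q. q \<noteq> 0 \<and> coprime p q \<and> R = ratfun_cp1 p q)"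

definition period_lattice :: "complex \<Rightarrow> complex \<Rightarrow> complex set" where
  "period_lattice \<omega>1 \<omega>2 = {of_int m * \<omega>1 + of_int n * \<omega>2 | m n. True}"

(* On the lattice the term 1 / z^2, or the term of the sum with \<omega> = z, has a pole. *)
definition weierstrass_p :: "complex set \<Rightarrow> complex \<Rightarrow> cp1" where
  "weierstrass_p \<Lambda> z =
     (if z \<in> \<Lambda> then CP_inf
      else CP_fin (1 / z\<^sup>2 + (\<Sum>\<^sub>\<infinity>\<omega>\<in>\<Lambda> - {0}. (1 / (z - \<omega>)\<^sup>2 - 1 / \<omega>\<^sup>2))))"

(* The subgroup generated inside the group of all bijections of the plane. *)
definition wallpaper_p2 :: "complex set \<Rightarrow> (complex \<Rightarrow> complex) set" where
  "wallpaper_p2 \<Lambda> =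
     generate (BijGroup UNIV) (insert (\<lambda>z. - z) {\<lambda>z. z + \<omega> | \<omega>. \<omega> \<in> \<Lambda>})"

definition invariant_under :: "(complex \<Rightarrow> complex) set \<Rightarrow> (complex \<Rightarrow> 'a) \<Rightarrow> bool" where
  "invariant_under G f \<longleftrightarrow> (\<forall>g\<in>G. \<forall>z. f (g z) = f z)"

end

(*
  The function wp is even and periodic, with a double pole at each lattice point, so every R(wp) is
  meromorphic and invariant.  Conversely, let g be meromorphic, even and periodic.  A pole of g at a
  point a outside the lattice is cancelled by a power of wp - wp(a), and modulo the lattice there are
  only finitely many poles; so some nonzero polynomial in wp times g has no pole outside the lattice.
  If such a product G satisfies z^(2n) G(z) -> c at 0 with n > 0, then z^(2n) (G - c wp^n) is even
  and vanishes at 0, hence vanishes there to second order, and n drops by one.  When n = 0, the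
  function is constant by Liouville's theorem.  So G is a polynomial in wp and no counting of zeros
  is needed.
*)
theory Submission
  imports Defs "HOL-Computational_Algebra.Field_as_Ring"
begin

section \<open>Rational functions at infinity and meromorphic functions at a point\<close>

lemma eventually_poly_neq_0_at_infinity:
  fixes p :: "'a::real_normed_field poly"
  assumes "p \<noteq> 0"
  shows "\<forall>\<^sub>F x in at_infinity. poly p x \<noteq> 0"
proof -
  have "bounded {x. poly p x = 0}"
    using assms by (intro finite_imp_bounded poly_roots_finite)
  then obtain B where "\<And>x. poly p x = 0 \<Longrightarrow> norm x \<le> B"
    by (auto simp: bounded_iff)
  then show ?thesis
    by (intro eventually_at_infinityI[of "B + 1"]) (smt (verit))
qed

lemma poly_divide_tendsto_at_infinity:
  fixes p q :: "'a::real_normed_field poly"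
  assumes deg: "degree p \<le> degree q" and q: "q \<noteq> 0"
  shows "((\<lambda>x. poly p x / poly q x) \<longlongrightarrow> coeff p (degree q) / lead_coeff q) at_infinity"
proof (cases "degree p = degree q")
  case True
  let ?n = "degree q"
  have "((\<lambda>x. (poly p x / x ^ ?n) / (poly q x / x ^ ?n)) \<longlongrightarrow> coeff p ?n / lead_coeff q) at_infinity"
    using poly_divide_tendsto_aux[of p] poly_divide_tendsto_aux[of q] q True
    by (intro tendsto_divide) auto
  moreover have "\<forall>\<^sub>F x::'a in at_infinity. poly p x / poly q x = (poly p x / x ^ ?n) / (poly q x / x ^ ?n)"
    by (rule eventually_at_infinityI[of 1]) auto
  ultimately show ?thesis
    by (subst tendsto_cong) auto
next
  case False
  then show ?thesis
    using deg poly_divide_tendsto_0_at_infinity[of p q] by (simp add: coeff_eq_0)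
qed

lemma filterlim_poly_divide_at_infinity:
  fixes p q :: "'a::real_normed_field poly"
  assumes deg: "degree q < degree p" and q: "q \<noteq> 0"
  shows "filterlim (\<lambda>x. poly p x / poly q x) at_infinity at_infinity"
proof -
  have "p \<noteq> 0"
    using deg by auto
  then have "\<forall>\<^sub>F x in at_infinity. poly q x / poly p x \<noteq> 0"
    using eventually_poly_neq_0_at_infinity[of p] eventually_poly_neq_0_at_infinity[of q] q
    by (auto elim: eventually_elim2)
  then have "filterlim (\<lambda>x. poly q x / poly p x) (at 0) at_infinity"
    using poly_divide_tendsto_0_at_infinity[OF deg] by (auto simp: filterlim_at)
  then have "filterlim (\<lambda>x. inverse (poly q x / poly p x)) at_infinity at_infinity"
    by (rule filterlim_compose[OF filterlim_inverse_at_infinity])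
  then show ?thesis
    by simp
qed

section \<open>Limits and poles of meromorphic functions at a single point\<close>

lemma meromorphic_on_poly [meromorphic_intros]:
  "f meromorphic_on A \<Longrightarrow> (\<lambda>z. poly p (f z)) meromorphic_on A"
  by (induction p) (auto intro!: meromorphic_intros)

lemma nicely_meromorphic_tendsto:
  assumes "g nicely_meromorphic_on A" "z \<in> A" "g \<midarrow>z\<rightarrow> l"
  shows "\<not> is_pole g z" "g z = l"
proof -
  show np: "\<not> is_pole g z"
    using assms(3) not_tendsto_and_filterlim_at_infinity[of "at z" g l] by (auto simp: is_pole_def)
  then have "g \<midarrow>z\<rightarrow> g z"
    using assms(1,2) by (auto simp: nicely_meromorphic_on_def)
  then show "g z = l"
    using assms(3) LIM_unique by blast
qed

lemma meromorphic_clear_pole: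
  assumes "f meromorphic_on {a}"
  obtains n l where "(\<lambda>z. (z - a) ^ n * f z) \<midarrow>a\<rightarrow> l"
proof (cases "is_pole f a")
  case False
  then obtain l where "f \<midarrow>a\<rightarrow> l"
    using meromorphic_on_not_essential[OF assms] by (auto simp: not_essential_def)
  then show ?thesis
    using that[of 0 l] by simp
next
  case True
  obtain r where r: "r > 0" "f analytic_on ball a r - {a}"
    using meromorphic_on_isolated_singularity[OF assms] by (auto simp: isolated_singularity_at_def)
  \<comment> \<open>At a pole \<open>zorder f a\<close> is negative, so \<open>k\<close> is the
    multiplicity of the pole and \<open>zor_poly f a\<close> the holomorphic factor left after
    clearing it.\<close>
  define k where "k = nat (- zorder f a)"
  have "\<exists>s>0. cball a s \<subseteq> ball a r \<and> zor_poly f a holomorphic_on cball a s \<and>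
      (\<forall>w\<in>cball a s - {a}. f w = zor_poly f a w / (w - a) ^ k \<and> zor_poly f a w \<noteq> 0)"
    using zorder_exist_pole[of f "ball a r" a] r True
    by (auto simp: k_def analytic_imp_holomorphic)
  then obtain s where s: "s > 0" "zor_poly f a holomorphic_on cball a s"
      "\<And>w. w \<in> cball a s - {a} \<Longrightarrow> f w = zor_poly f a w / (w - a) ^ k"
    by blast
  have "zor_poly f a holomorphic_on ball a s"
    using s(2) by (rule holomorphic_on_subset) auto
  then have "zor_poly f a \<midarrow>a\<rightarrow> zor_poly f a a"
    using s(1) by (meson analytic_at_imp_isCont centre_in_ball holomorphic_on_imp_analytic_at
        isContD open_ball)
  moreover have "\<forall>\<^sub>F w in at a. zor_poly f a w = (w - a) ^ k * f w"
    using eventually_at_in_open[of "ball a s" a] s(1)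
    by (auto elim!: eventually_mono simp: s(3))
  ultimately show ?thesis
    using that[of k "zor_poly f a a"] by (simp add: tendsto_cong)
qed

text \<open>Once the singularity is removed, \<open>F\<close> is holomorphic with a zero at 0, and
  \<open>F z / z\<close> is odd. Its limit at 0 equals its own negative, which kills the first-order
  coefficient.\<close>

lemma even_tendsto_0_imp_double_zero:
  assumes mero: "F meromorphic_on {0}" and even: "\<And>z. F (- z) = F z" and lim: "F \<midarrow>0\<rightarrow> 0"
  obtains l where "(\<lambda>z. F z / z\<^sup>2) \<midarrow>0\<rightarrow> l"
proof -
  define H where "H = remove_sings F"
  have iso: "isolated_singularity_at F 0"
    using mero by (rule meromorphic_on_isolated_singularity)
  have H0: "H 0 = 0"
    unfolding H_def using lim by (rule remove_sings_eqI)
  have "H \<midarrow>0\<rightarrow> 0"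
    unfolding H_def using lim iso by simp
  then have "isCont H 0"
    using H0 by (simp add: isCont_def)
  then have "H analytic_on {0}"
    using remove_sings_meromorphic[OF mero] unfolding H_def
    by (intro meromorphic_at_isCont_imp_analytic)
  then obtain e where e: "e > 0" "H holomorphic_on ball 0 e"
    by (auto simp: analytic_on_def)
  have eq: "\<forall>\<^sub>F z in at 0. H z = F z"
    unfolding H_def using iso by (rule eventually_remove_sings_eq_at)
  \<comment> \<open>The difference quotient of \<open>H\<close>, completed at 0 by the derivative,
    is holomorphic, so it has a difference quotient of its own; that one is
    \<open>F z / z\<^sup>2\<close> once \<open>K 0 = 0\<close> is known.\<close>
  define K where "K z = (if z = 0 then deriv H 0 else (H z - H 0) / (z - 0))" for z
  have "K holomorphic_on ball 0 e"
    unfolding K_def[abs_def] using e by (intro pole_lemma_open) auto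
  then have K: "K field_differentiable at 0"
    using e(1) by (auto simp: holomorphic_on_open field_differentiable_def)
  have KF: "\<forall>\<^sub>F z in at 0. K z = F z / z"
    using eq unfolding eventually_at_filter by eventually_elim (auto simp: K_def H0)
  have K_lim: "K \<midarrow>0\<rightarrow> K 0"
    using field_differentiable_imp_continuous_at[OF K] by (simp add: isCont_def)
  then have F_lim: "(\<lambda>z. F z / z) \<midarrow>0\<rightarrow> K 0"
    using KF by (simp add: tendsto_cong)
  have "filterlim uminus (at 0) (at (0::complex))"
    by (simp add: filterlim_def filtermap_at_minus)
  then have "(\<lambda>z. F (- z) / (- z)) \<midarrow>0\<rightarrow> K 0"
    by (rule filterlim_compose[OF F_lim])
  then have "(\<lambda>z. - (F z / z)) \<midarrow>0\<rightarrow> K 0"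
    by (simp add: even)
  moreover have "(\<lambda>z. - (F z / z)) \<midarrow>0\<rightarrow> - K 0"
    using F_lim by (rule tendsto_minus)
  ultimately have "K 0 = - K 0"
    by (rule LIM_unique)
  then have K0: "K 0 = 0"
    by simp
  have "(\<lambda>z. (K z - K 0) / (z - 0)) \<midarrow>0\<rightarrow> deriv K 0"
    using field_differentiable_derivI[OF K] by (simp only: has_field_derivative_iff)
  moreover have "\<forall>\<^sub>F z in at 0. (K z - K 0) / (z - 0) = F z / z\<^sup>2"
    using KF by eventually_elim (simp add: K0 power2_eq_square)
  ultimately show ?thesis
    using that by (simp add: tendsto_cong)
qed

section \<open>Lattices in the plane\<close>

lemma summable_on_powr_int: "(\<lambda>m::int. (1 + \<bar>real_of_int m\<bar>) powr (-3/2)) summable_on UNIV"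
proof -
  let ?f = "\<lambda>m::int. (1 + \<bar>real_of_int m\<bar>) powr (-3/2)"
  have "summable (\<lambda>n::nat. real n powr (-3/2))"
    by (subst summable_real_powr_iff) auto
  then have "summable (\<lambda>n::nat. real (Suc n) powr (-3/2))"
    by (subst summable_Suc_iff)
  then have nat: "(\<lambda>n::nat. (1 + real n) powr (-3/2)) summable_on UNIV"
    by (subst summable_on_UNIV_nonneg_real_iff) (auto simp: add_ac)
  have "?f summable_on range int"
    using nat by (subst summable_on_reindex) (auto simp: o_def)
  moreover have "?f summable_on range (\<lambda>n. - int n)"
    using nat by (subst summable_on_reindex) (auto simp: o_def inj_on_def)
  ultimately have "?f summable_on range int \<union> range (\<lambda>n. - int n)"
    by (rule summable_on_union)
  moreover have "range int \<union> range (\<lambda>n. - int n) = UNIV"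
    by (auto simp: image_iff) (metis int_cases2)
  ultimately show ?thesis
    by simp
qed

text \<open>Over a common denominator the squares of \<open>w\<close> cancel, leaving a numerator
  linear in \<open>w\<close>; this gains the power of \<open>norm w\<close> needed for absolute
  convergence.\<close>

lemma norm_weierstrass_term_le:
  fixes z w :: complex
  assumes z: "norm z \<le> R" and w: "2 * R < norm w"
  shows "norm (1 / (z - w)\<^sup>2 - 1 / w\<^sup>2) \<le> 10 * R * (1 / norm w ^ 3)"
proof -
  have R: "R \<ge> 0" and w0: "norm w > 0"
    using z w norm_ge_zero[of z] by linarith+
  have zw: "norm (z - w) \<ge> norm w / 2"
    using z w norm_triangle_ineq2[of w z] by (simp add: norm_minus_commute)
  then have ne: "w \<noteq> 0" "z - w \<noteq> 0"
    using w0 by auto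
  have "1 / (z - w)\<^sup>2 - 1 / w\<^sup>2 = z * (2 * w - z) / (w\<^sup>2 * (z - w)\<^sup>2)"
  proof -
    have "w\<^sup>2 - (z - w)\<^sup>2 = z * (2 * w - z)"
      by algebra
    then show ?thesis
      using ne by (simp add: diff_frac_eq mult.commute)
  qed
  also have "norm \<dots> = norm z * norm (2 * w - z) / (norm w ^ 2 * norm (z - w) ^ 2)"
    by (simp add: norm_mult norm_divide norm_power)
  \<comment> \<open>Since \<open>norm z\<close> is at most half of \<open>norm w\<close>, the
    numerator factor is at most 5/2 times \<open>norm w\<close> and \<open>norm (z - w)\<close> is
    at least half of it; 10 is 5/2 times 4.\<close>
  also have "\<dots> \<le> R * (5/2 * norm w) / (norm w ^ 2 * (norm w / 2) ^ 2)"
  proof (intro frac_le mult_mono power_mono zw z)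
    have "norm (2 * w - z) \<le> norm (2 * w) + norm z"
      by (rule norm_triangle_ineq4)
    then show "norm (2 * w - z) \<le> 5/2 * norm w"
      using z w by (simp add: norm_mult)
  qed (use R w0 in auto)
  also have "\<dots> = 10 * R * (1 / norm w ^ 3)"
    using w0 by (simp add: field_simps power2_eq_square power3_eq_cube)
  finally show ?thesis .
qed

section \<open>Real coordinates, discreteness and lattice sums\<close>

locale plane_lattice =
  fixes \<omega>1 \<omega>2 :: complex
  assumes nonzero: "\<omega>1 \<noteq> 0" "\<omega>2 \<noteq> 0" and ratio_not_real: "\<omega>1 / \<omega>2 \<notin> \<real>"
begin

abbreviation \<Lambda> where "\<Lambda> \<equiv> period_lattice \<omega>1 \<omega>2"

lemma zero_in_lattice: "0 \<in> \<Lambda>"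
  unfolding period_lattice_def by (intro CollectI exI[of _ 0]) simp

lemma uminus_in_lattice: "v \<in> \<Lambda> \<Longrightarrow> - v \<in> \<Lambda>"
  unfolding period_lattice_def
  by clarify (metis (no_types, opaque_lifting) minus_add_distrib mult_minus_left of_int_minus)

lemma add_in_lattice: "v \<in> \<Lambda> \<Longrightarrow> w \<in> \<Lambda> \<Longrightarrow> v + w \<in> \<Lambda>"
proof -
  assume "v \<in> \<Lambda>" "w \<in> \<Lambda>"
  then obtain m n k l where "v = of_int m * \<omega>1 + of_int n * \<omega>2" "w = of_int k * \<omega>1 + of_int l * \<omega>2"
    unfolding period_lattice_def by blast
  then have "v + w = of_int (m + k) * \<omega>1 + of_int (n + l) * \<omega>2"
    by (simp add: algebra_simps)
  then show ?thesis
    unfolding period_lattice_def by blast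
qed

lemma diff_in_lattice: "v \<in> \<Lambda> \<Longrightarrow> w \<in> \<Lambda> \<Longrightarrow> v - w \<in> \<Lambda>"
  using add_in_lattice[of v "- w"] uminus_in_lattice[of w] by simp

lemma add_in_lattice_iff: "v \<in> \<Lambda> \<Longrightarrow> z + v \<in> \<Lambda> \<longleftrightarrow> z \<in> \<Lambda>"
  using add_in_lattice[of z v] diff_in_lattice[of "z + v" v] by auto

lemma uminus_in_lattice_iff: "- z \<in> \<Lambda> \<longleftrightarrow> z \<in> \<Lambda>"
  using uminus_in_lattice[of z] uminus_in_lattice[of "- z"] by auto

text \<open>Up to sign, the area of the parallelogram spanned by the periods, that is, the
  determinant of the coordinate change.\<close>

definition area where "area = Im (\<omega>1 * cnj \<omega>2)"

lemma area_nonzero: "area \<noteq> 0"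
proof
  assume "area = 0"
  then have "\<omega>1 * cnj \<omega>2 \<in> \<real>"
    by (simp add: area_def complex_is_Real_iff)
  moreover have "\<omega>1 / \<omega>2 = (\<omega>1 * cnj \<omega>2) / of_real ((norm \<omega>2)\<^sup>2)"
    by (rule complex_div_cnj)
  ultimately show False
    using ratio_not_real by (metis Reals_divide Reals_of_real)
qed

text \<open>Cramer's rule: multiplying by the conjugate of one period makes the contribution of that
  period real, so the imaginary part isolates the other coordinate.\<close>

lemma coords_unique:
  assumes "z = of_real a * \<omega>1 + of_real b * \<omega>2"
  shows "a * area = Im (z * cnj \<omega>2)" "b * area = - Im (z * cnj \<omega>1)"
  using assms by (auto simp: area_def algebra_simps)

lemma coords_exist: "\<exists>a b. z = of_real a * \<omega>1 + of_real b * \<omega>2"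
proof (intro exI)
  have "of_real area * z =
      of_real (Im (z * cnj \<omega>2)) * \<omega>1 + of_real (- Im (z * cnj \<omega>1)) * \<omega>2"
    by (auto simp: area_def complex_eq_iff algebra_simps)
  then have "z = (of_real (Im (z * cnj \<omega>2)) * \<omega>1 + of_real (- Im (z * cnj \<omega>1)) * \<omega>2) / of_real area"
    using area_nonzero by (metis nonzero_mult_div_cancel_left of_real_eq_0_iff)
  then show "z = of_real (Im (z * cnj \<omega>2) / area) * \<omega>1 + of_real (- Im (z * cnj \<omega>1) / area) * \<omega>2"
    by (simp only: of_real_divide add_divide_distrib times_divide_eq_left)
qed

text \<open>Quantitative linear independence of the periods. Injectivity of the parametrisation,
  discreteness of the lattice and convergence of the lattice sum all rest on it.\<close>

lemma coords_bound:
  obtains c where "c > 0"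
    "\<And>a b. c * max \<bar>a\<bar> \<bar>b\<bar> \<le> norm (of_real a * \<omega>1 + of_real b * \<omega>2)"
proof -
  define M where "M = max (norm \<omega>1) (norm \<omega>2)"
  have M: "M > 0" "norm \<omega>1 \<le> M" "norm \<omega>2 \<le> M"
    using nonzero by (auto simp: M_def less_max_iff_disj)
  have "\<bar>area\<bar> / M * max \<bar>a\<bar> \<bar>b\<bar> \<le> norm (of_real a * \<omega>1 + of_real b * \<omega>2)" for a b
  proof -
    define z where "z = of_real a * \<omega>1 + of_real b * \<omega>2"
    have "\<bar>a\<bar> * \<bar>area\<bar> = \<bar>Im (z * cnj \<omega>2)\<bar>"
      using coords_unique(1)[OF z_def] by (metis abs_mult)
    also have "\<dots> \<le> norm z * norm \<omega>2"
      by (metis abs_Im_le_cmod complex_mod_cnj norm_mult)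
    also have "\<dots> \<le> norm z * M"
      using M by (intro mult_left_mono) auto
    finally have a: "\<bar>a\<bar> * \<bar>area\<bar> \<le> norm z * M" .
    have "\<bar>b\<bar> * \<bar>area\<bar> = \<bar>Im (z * cnj \<omega>1)\<bar>"
      using coords_unique(2)[OF z_def] by (metis abs_mult abs_minus_cancel)
    also have "\<dots> \<le> norm z * norm \<omega>1"
      by (metis abs_Im_le_cmod complex_mod_cnj norm_mult)
    also have "\<dots> \<le> norm z * M"
      using M by (intro mult_left_mono) auto
    finally have b: "\<bar>b\<bar> * \<bar>area\<bar> \<le> norm z * M" .
    have "max \<bar>a\<bar> \<bar>b\<bar> * \<bar>area\<bar> \<le> norm z * M"
      using a b by (simp add: max_def)
    then show ?thesis
      using M unfolding z_def[symmetric] by (simp add: field_simps)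
  qed
  then show ?thesis
    using that[of "\<bar>area\<bar> / M"] area_nonzero M by auto
qed

definition lattice_point :: "int \<times> int \<Rightarrow> complex" where
  "lattice_point = (\<lambda>(m, n). of_int m * \<omega>1 + of_int n * \<omega>2)"

lemma lattice_eq_range: "\<Lambda> = range lattice_point"
  by (auto simp: period_lattice_def lattice_point_def image_iff)

lemma inj_lattice_point: "inj lattice_point"
proof (rule injI, clarify)
  fix m n m' n' assume eq: "lattice_point (m, n) = lattice_point (m', n')"
  obtain c where c: "c > 0"
    "\<And>a b. c * max \<bar>a\<bar> \<bar>b\<bar> \<le> norm (of_real a * \<omega>1 + of_real b * \<omega>2)"
    using coords_bound by blast
  have "c * max \<bar>real_of_int (m - m')\<bar> \<bar>real_of_int (n - n')\<bar> \<le> 0"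
    using c(2)[of "m - m'" "n - n'"] eq by (simp add: lattice_point_def algebra_simps)
  then show "m = m' \<and> n = n'"
    using c(1) by (auto simp: mult_le_0_iff max_def split: if_splits)
qed

lemma finite_lattice_bounded: "finite {w \<in> \<Lambda>. norm w \<le> R}"
proof -
  obtain c where c: "c > 0"
    "\<And>a b. c * max \<bar>a\<bar> \<bar>b\<bar> \<le> norm (of_real a * \<omega>1 + of_real b * \<omega>2)"
    using coords_bound by blast
  define N where "N = \<lceil>R / c\<rceil>"
  have "{w \<in> \<Lambda>. norm w \<le> R} \<subseteq> lattice_point ` ({-N..N} \<times> {-N..N})"
  proof
    fix w assume "w \<in> {w \<in> \<Lambda>. norm w \<le> R}"
    then obtain m n where w: "w = lattice_point (m, n)" "norm w \<le> R"
      unfolding lattice_eq_range by auto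
    have "c * max \<bar>real_of_int m\<bar> \<bar>real_of_int n\<bar> \<le> R"
      using c(2)[of m n] w by (simp add: lattice_point_def)
    then have "max \<bar>real_of_int m\<bar> \<bar>real_of_int n\<bar> \<le> R / c"
      using c(1) by (simp add: pos_le_divide_eq mult.commute del: max.bounded_iff)
    also have "\<dots> \<le> N"
      unfolding N_def by simp
    finally have "(m, n) \<in> {-N..N} \<times> {-N..N}"
      by (auto simp: max_def split: if_splits)
    then show "w \<in> lattice_point ` ({-N..N} \<times> {-N..N})"
      using w by blast
  qed
  then show ?thesis
    by (rule finite_subset) auto
qed

text \<open>By \<open>coords_bound\<close> each term is at most a constant times a product of two
  one-variable terms with exponent 3/2 > 1, so the double sum reduces to convergent single
  sums.\<close>

lemma summable_on_lattice: "(\<lambda>w. 1 / norm w ^ 3) summable_on \<Lambda>"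
proof -
  obtain c where c: "c > 0"
    "\<And>a b. c * max \<bar>a\<bar> \<bar>b\<bar> \<le> norm (of_real a * \<omega>1 + of_real b * \<omega>2)"
    using coords_bound by blast
  define h where "h m = (1 + \<bar>real_of_int m\<bar>) powr (-3/2)" for m
  define S where "S = infsum h UNIV"
  have h: "(h has_sum S) UNIV"
    using summable_on_powr_int unfolding S_def h_def by (rule has_sum_infsum)
  have hpos: "h m > 0" for m
    by (simp add: h_def)
  have "(\<lambda>(m, n). h m * h n) summable_on UNIV \<times> UNIV"
  proof (rule summable_on_SigmaI)
    show "((\<lambda>n. (case (m, n) of (m, n) \<Rightarrow> h m * h n)) has_sum h m * S) UNIV" for m
      using has_sum_cmult_right[OF h, of "h m"] by simp
    show "(\<lambda>m. h m * S) summable_on UNIV"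
      using h by (intro summable_on_cmult_left) (auto simp: summable_on_def)
  qed (use hpos in \<open>auto intro: less_imp_le\<close>)
  then have "(\<lambda>x. 8 / c ^ 3 * (case x of (m, n) \<Rightarrow> h m * h n)) summable_on UNIV"
    by (intro summable_on_cmult_right) simp
  then have "(\<lambda>x. 1 / norm (lattice_point x) ^ 3) summable_on UNIV"
  proof (rule summable_on_comparison_test)
    fix x :: "int \<times> int"
    obtain m n where x: "x = (m, n)" by force
    show "1 / norm (lattice_point x) ^ 3 \<le> 8 / c ^ 3 * (case x of (m, n) \<Rightarrow> h m * h n)"
    proof (cases "m = 0 \<and> n = 0")
      \<comment> \<open>The term at the origin is 0, because 1 / 0 = 0.\<close>
      case True
      then show ?thesis
        using hpos[of 0] c(1) by (simp add: x lattice_point_def)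
    next
      case False
      define k where "k = max \<bar>real_of_int m\<bar> \<bar>real_of_int n\<bar>"
      have k1: "k \<ge> 1"
        using False unfolding k_def by linarith
      \<comment> \<open>Writing 3 as 2 * 3/2 turns the cube into a power of a product of two factors
        \<open>2 * k\<close>, which dominate \<open>1 + |m|\<close> and \<open>1 + |n|\<close>
        because \<open>k \<ge> 1\<close>.\<close>
      have "(2 * k) powr (-3) = ((2 * k) powr 2) powr (-3/2)"
        by (simp add: powr_powr)
      also have "(2 * k) powr 2 = (2 * k) * (2 * k)"
        using k1 by (simp add: powr_numeral power2_eq_square)
      also have "(2 * k * (2 * k)) powr (-3/2) \<le>
                 ((1 + \<bar>real_of_int m\<bar>) * (1 + \<bar>real_of_int n\<bar>)) powr (-3/2)"
      proof (rule powr_mono2')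
        show "(1 + \<bar>real_of_int m\<bar>) * (1 + \<bar>real_of_int n\<bar>) \<le> 2 * k * (2 * k)"
          using k1 unfolding k_def by (intro mult_mono) auto
      qed (auto intro!: mult_pos_pos)
      also have "\<dots> = h m * h n"
        by (simp add: h_def powr_mult)
      finally have *: "(2 * k) powr (-3) \<le> h m * h n" .
      have "(2 * k) powr (-3) = 1 / (8 * k ^ 3)"
        using k1 by (simp add: powr_minus powr_numeral field_simps power_mult_distrib)
      with * have **: "1 / k ^ 3 \<le> 8 * (h m * h n)"
        by simp
      have "c * k > 0" "c * k \<le> norm (lattice_point x)"
        using c(2)[of m n] k1 c(1) by (auto simp: x lattice_point_def k_def[symmetric])
      then have "1 / norm (lattice_point x) ^ 3 \<le> 1 / (c * k) ^ 3"
        by (intro frac_le power_mono) auto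
      also have "\<dots> = 1 / c ^ 3 * (1 / k ^ 3)"
        by (simp add: power_mult_distrib)
      also have "\<dots> \<le> 1 / c ^ 3 * (8 * (h m * h n))"
        using ** c(1) by (intro mult_left_mono) auto
      finally show ?thesis
        by (simp add: x)
    qed
  qed auto
  then show ?thesis
    unfolding lattice_eq_range
    by (subst summable_on_reindex[OF inj_lattice_point]) (simp add: o_def)
qed


subsection \<open>The Weierstrass function\<close>

definition wp_term :: "complex \<Rightarrow> complex \<Rightarrow> complex" where
  "wp_term w z = 1 / (z - w)\<^sup>2 - 1 / w\<^sup>2"

text \<open>
  The summand for \<open>w = 0\<close> is \<open>1 / z\<^sup>2\<close>, since \<open>1 / 0 = 0\<close>; hence the sum runs over the whole lattice.
\<close>
definition wp :: "complex \<Rightarrow> complex" where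
  "wp z = (\<Sum>\<^sub>\<infinity>w\<in>\<Lambda>. wp_term w z)"

lemma wp_term_analytic: "z \<noteq> w \<Longrightarrow> wp_term w analytic_on {z}"
  unfolding wp_term_def by (intro analytic_intros) auto

text \<open>Outside a finite set of small lattice points the cubic estimate applies. The subset
  \<open>A\<close> allows single terms to be split off later.\<close>

lemma summable_on_wp_term:
  assumes "A \<subseteq> \<Lambda>"
  shows "(\<lambda>w. wp_term w z) summable_on A"
proof -
  define B where "B = {w \<in> \<Lambda>. norm w \<le> 2 * norm z}"
  have "(\<lambda>w. 10 * norm z * (1 / norm w ^ 3)) summable_on \<Lambda> - B"
    by (rule summable_on_cmult_right, rule summable_on_subset[OF summable_on_lattice]) auto
  then have "(\<lambda>w. norm (wp_term w z)) summable_on \<Lambda> - B"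
    by (rule Infinite_Sum.abs_summable_on_comparison_test')
      (auto simp: wp_term_def B_def intro!: norm_weierstrass_term_le[of z "norm z", simplified])
  then have "(\<lambda>w. wp_term w z) summable_on \<Lambda> - B"
    by (rule abs_summable_summable)
  moreover have "(\<lambda>w. wp_term w z) summable_on B"
    unfolding B_def by (intro summable_on_finite finite_lattice_bounded)
  ultimately have "(\<lambda>w. wp_term w z) summable_on (\<Lambda> - B) \<union> B"
    by (rule summable_on_union)
  then show ?thesis
    by (rule summable_on_subset) (use assms in auto)
qed

text \<open>The index set is a parameter so that the lemma covers both \<open>wp\<close> and the
  series with one term removed, which is analytic even at the omitted lattice point.\<close>

lemma infsum_wp_term_analytic:
  assumes A: "A \<subseteq> \<Lambda>" and z: "z \<notin> A"
  shows "(\<lambda>u. \<Sum>\<^sub>\<infinity>w\<in>A. wp_term w u) analytic_on {z}"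
proof -
  \<comment> \<open>The extra 1 puts \<open>z\<close> inside the open disc of radius
    \<open>R\<close>. Indices outside \<open>F\<close> exceed \<open>2 * R\<close> in norm: the
    estimate applies to them and their poles lie outside the disc.\<close>
  define R where "R = norm z + 1"
  define F where "F = {w \<in> A. norm w \<le> 2 * R}"
  have "F \<subseteq> {w \<in> \<Lambda>. norm w \<le> 2 * R}"
    using A by (auto simp: F_def)
  then have "finite F"
    using finite_lattice_bounded by (rule finite_subset)
  moreover have "F \<subseteq> A" "z \<notin> F"
    using z by (auto simp: F_def)
  ultimately have F: "finite F" "F \<subseteq> A" "z \<notin> F"
    by blast+
  define far where "far u = (\<Sum>\<^sub>\<infinity>w\<in>A - F. wp_term w u)" for u
  have ulim: "uniform_limit (cball 0 R) (\<lambda>X u. \<Sum>w\<in>X. wp_term w u) far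
                (finite_subsets_at_top (A - F))"
    unfolding far_def
  proof (rule Weierstrass_m_test_general)
    show "norm (wp_term w u) \<le> 10 * R * (1 / norm w ^ 3)" if "w \<in> A - F" "u \<in> cball 0 R" for w u
      using that unfolding wp_term_def by (intro norm_weierstrass_term_le) (auto simp: F_def)
    show "(\<lambda>w. 10 * R * (1 / norm w ^ 3)) summable_on A - F"
      by (rule summable_on_cmult_right, rule summable_on_subset[OF summable_on_lattice]) (use A in auto)
  qed
  have hol: "(\<lambda>u. \<Sum>w\<in>X. wp_term w u) holomorphic_on cball 0 R" if "X \<subseteq> A - F" for X
  proof (intro holomorphic_intros analytic_imp_holomorphic)
    fix w assume "w \<in> X"
    then have "norm w > 2 * R"
      using that by (auto simp: F_def)
    moreover have "R > 0"
      unfolding R_def by (simp add: add_nonneg_pos)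
    ultimately have "wp_term w analytic_on {u}" if "u \<in> cball 0 R" for u
      using that by (intro wp_term_analytic) auto
    then show "wp_term w analytic_on cball 0 R"
      by (subst analytic_on_analytic_at) blast
  qed
  have "far holomorphic_on ball 0 R"
  proof (rule holomorphic_uniform_limit[OF _ ulim])
    show "\<forall>\<^sub>F X in finite_subsets_at_top (A - F).
        continuous_on (cball 0 R) (\<lambda>u. \<Sum>w\<in>X. wp_term w u) \<and>
        (\<lambda>u. \<Sum>w\<in>X. wp_term w u) holomorphic_on ball 0 R"
      by (rule eventually_finite_subsets_at_top_weakI)
        (auto intro: holomorphic_on_imp_continuous_on[OF hol] holomorphic_on_subset[OF hol])
  qed auto
  then have far: "far analytic_on {z}"
    by (rule holomorphic_on_imp_analytic_at) (auto simp: R_def)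
  have "(\<lambda>u. \<Sum>\<^sub>\<infinity>w\<in>A. wp_term w u) = (\<lambda>u. (\<Sum>w\<in>F. wp_term w u) + far u)"
  proof
    fix u
    have "(\<Sum>\<^sub>\<infinity>w\<in>F \<union> (A - F). wp_term w u) = (\<Sum>\<^sub>\<infinity>w\<in>F. wp_term w u) + far u"
      unfolding far_def using A F by (intro infsum_Un_disjoint summable_on_wp_term) auto
    then show "(\<Sum>\<^sub>\<infinity>w\<in>A. wp_term w u) = (\<Sum>w\<in>F. wp_term w u) + far u"
      using F by (simp add: Un_absorb1)
  qed
  moreover have "(\<lambda>u. (\<Sum>w\<in>F. wp_term w u) + far u) analytic_on {z}"
    using F by (intro analytic_intros far wp_term_analytic) auto
  ultimately show ?thesis
    by simp
qed

lemma wp_analytic: "z \<notin> \<Lambda> \<Longrightarrow> wp analytic_on {z}"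
  unfolding wp_def[abs_def] by (rule infsum_wp_term_analytic) auto

lemma wp_split:
  assumes "v \<in> \<Lambda>"
  shows "wp z = wp_term v z + (\<Sum>\<^sub>\<infinity>w\<in>\<Lambda> - {v}. wp_term w z)"
  using infsum_insert[OF summable_on_wp_term[of "\<Lambda> - {v}" z], of v] assms
  by (simp add: wp_def insert_absorb)

lemma wp_even: "wp (- z) = wp z"
proof -
  have "wp z = (\<Sum>\<^sub>\<infinity>w\<in>\<Lambda>. wp_term w (- z))"
    unfolding wp_def
    by (rule infsum_reindex_bij_witness[of _ uminus uminus])
      (auto simp: uminus_in_lattice wp_term_def power2_eq_square algebra_simps)
  then show ?thesis
    by (simp add: wp_def)
qed

text \<open>Shifting the index along with \<open>z\<close> makes the termwise difference independent
  of \<open>z\<close>, so \<open>wp (z + v) - wp z\<close> is a constant \<open>d\<close>; a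
  symmetry of the lattice forces \<open>d = - d\<close>.\<close>

lemma wp_periodic:
  assumes v: "v \<in> \<Lambda>"
  shows "wp (z + v) = wp z"
proof -
  define d where "d = (\<Sum>\<^sub>\<infinity>w\<in>\<Lambda>. 1 / w\<^sup>2 - 1 / (w + v)\<^sup>2)"
  have shift: "wp_term (w + v) (z + v) - wp_term w z = 1 / w\<^sup>2 - 1 / (w + v)\<^sup>2" for w
    by (simp add: wp_term_def)
  have bij: "bij_betw (\<lambda>w. w + v) \<Lambda> \<Lambda>"
    using v by (intro bij_betwI[of _ _ _ "\<lambda>w. w - v"]) (auto simp: add_in_lattice diff_in_lattice)
  have "wp (z + v) = (\<Sum>\<^sub>\<infinity>w\<in>\<Lambda>. wp_term (w + v) (z + v))"
    unfolding wp_def using infsum_reindex_bij_betw[OF bij, of "\<lambda>w. wp_term w (z + v)"] by simp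
  moreover have "(\<lambda>w. wp_term (w + v) (z + v)) summable_on \<Lambda>"
    using summable_on_reindex_bij_betw[OF bij, of "\<lambda>w. wp_term w (z + v)"]
      summable_on_wp_term[of \<Lambda> "z + v"] by simp
  ultimately have "((\<lambda>w. wp_term (w + v) (z + v)) has_sum wp (z + v)) \<Lambda>"
    by simp
  moreover have "((\<lambda>w. - wp_term w z) has_sum - wp z) \<Lambda>"
    unfolding wp_def by (intro has_sum_uminusI has_sum_infsum summable_on_wp_term) simp
  ultimately have "((\<lambda>w. wp_term (w + v) (z + v) + - wp_term w z) has_sum wp (z + v) + - wp z) \<Lambda>"
    by (rule has_sum_add)
  then have "wp (z + v) - wp z = (\<Sum>\<^sub>\<infinity>w\<in>\<Lambda>. wp_term (w + v) (z + v) - wp_term w z)"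
    by (simp add: infsumI)
  also have "\<dots> = d"
    unfolding d_def by (simp only: shift)
  finally have diff: "wp (z + v) - wp z = d" .
  \<comment> \<open>The substitution \<open>w \<mapsto> - w - v\<close> changes the sign of the summand of \<open>d\<close>.\<close>
  have "d = (\<Sum>\<^sub>\<infinity>w\<in>\<Lambda>. - (1 / w\<^sup>2 - 1 / (w + v)\<^sup>2))"
    unfolding d_def
    by (rule infsum_reindex_bij_witness[of _ "\<lambda>w. - w - v" "\<lambda>w. - w - v"])
      (auto simp: uminus_in_lattice diff_in_lattice v power2_eq_square algebra_simps)
  then have "d = - d"
    by (simp only: infsum_uminus d_def)
  with diff show ?thesis
    by simp
qed

lemma wp_minus_double_pole:
  assumes "v \<in> \<Lambda>"
  shows "(\<lambda>z. wp z - 1 / (z - v)\<^sup>2) analytic_on {v}"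
proof -
  have "(\<lambda>z. - 1 / v\<^sup>2 + (\<Sum>\<^sub>\<infinity>w\<in>\<Lambda> - {v}. wp_term w z)) analytic_on {v}"
    by (intro analytic_on_add analytic_on_const infsum_wp_term_analytic) auto
  moreover have "wp z - 1 / (z - v)\<^sup>2 = - 1 / v\<^sup>2 + (\<Sum>\<^sub>\<infinity>w\<in>\<Lambda> - {v}. wp_term w z)" for z
    using wp_split[OF assms, of z] by (simp add: wp_term_def)
  ultimately show ?thesis
    by simp
qed

lemma wp_meromorphic: "wp meromorphic_on UNIV"
proof (subst meromorphic_on_meromorphic_at, safe)
  fix z
  show "wp meromorphic_on {z}"
  proof (cases "z \<in> \<Lambda>")
    case True
    have "(\<lambda>u. (wp u - 1 / (u - z)\<^sup>2) + 1 / (u - z)\<^sup>2) meromorphic_on {z}"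
      by (intro meromorphic_intros analytic_on_imp_meromorphic_on wp_minus_double_pole True)
        (auto intro!: analytic_intros)
    then show ?thesis
      by simp
  qed (simp add: wp_analytic analytic_on_imp_meromorphic_on)
qed

text \<open>The leading coefficient 1 at the origin is what lets a power of \<open>wp\<close> cancel
  the leading pole term in \<open>polynomial_in_wp\<close>.\<close>

lemma square_times_wp_tendsto: "(\<lambda>z. z\<^sup>2 * wp z) \<midarrow>0\<rightarrow> 1"
proof -
  define h where "h z = wp z - 1 / (z - 0)\<^sup>2" for z
  have "isCont h 0"
    unfolding h_def[abs_def]
    using wp_minus_double_pole[OF zero_in_lattice] by (rule analytic_at_imp_isCont)
  then have "(\<lambda>z. z\<^sup>2 * h z + 1) \<midarrow>0\<rightarrow> 0\<^sup>2 * h 0 + 1"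
    unfolding isCont_def by (intro tendsto_intros)
  moreover have "\<forall>\<^sub>F z in at 0. z\<^sup>2 * h z + 1 = z\<^sup>2 * wp z"
    by (auto simp: h_def eventually_at_filter field_simps)
  ultimately show ?thesis
    using Lim_transform_eventually by fastforce
qed

lemma wp_pole:
  assumes "v \<in> \<Lambda>"
  shows "is_pole wp v"
proof -
  have "is_pole (\<lambda>z. (wp z - 1 / (z - v)\<^sup>2) + 1 / (z - v) ^ 2) v"
    unfolding is_pole_def
  proof (rule tendsto_add_filterlim_at_infinity)
    show "(\<lambda>z. wp z - 1 / (z - v)\<^sup>2) \<midarrow>v\<rightarrow> wp v - 1 / (v - v)\<^sup>2"
      using analytic_at_imp_isCont[OF wp_minus_double_pole[OF assms]] by (simp add: isCont_def)
    show "filterlim (\<lambda>z. 1 / (z - v) ^ 2) at_infinity (at v)"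
      using is_pole_inverse_power[of 2 v] by (simp add: is_pole_def)
  qed
  then show ?thesis
    by simp
qed

lemma weierstrass_p_eq: "weierstrass_p \<Lambda> z = (if z \<in> \<Lambda> then CP_inf else CP_fin (wp z))"
  using wp_split[OF zero_in_lattice, of z] by (simp add: weierstrass_p_def wp_term_def)

lemma wp_tendsto: "z \<notin> \<Lambda> \<Longrightarrow> wp \<midarrow>z\<rightarrow> wp z"
  by (intro isContD analytic_at_imp_isCont wp_analytic)

section \<open>Limits along the lattice and sphere values of rational functions of
  \<open>wp\<close>\<close>

lemma periodic_tendsto:
  assumes "\<And>z v. v \<in> \<Lambda> \<Longrightarrow> f (z + v) = f z" and "f \<midarrow>z\<rightarrow> l" and v: "v \<in> \<Lambda>"
  shows "f \<midarrow>z + v\<rightarrow> l"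
  using LIM_offset[OF assms(2), of "- v"] assms(1)[OF uminus_in_lattice[OF v]] by simp

text \<open>By the identity theorem the composite vanishes near every point or is nonzero near every
  point; near the lattice point 0 the values of \<open>wp\<close> escape all roots of
  \<open>q\<close>.\<close>

lemma poly_wp_nonzero:
  assumes q: "q \<noteq> 0"
  shows "\<forall>\<^sub>F w in at z. poly q (wp w) \<noteq> 0"
proof -
  have "(\<lambda>w. poly q (wp w)) meromorphic_on UNIV"
    by (intro meromorphic_intros wp_meromorphic)
  then consider "\<forall>z. \<forall>\<^sub>F w in at z. poly q (wp w) = 0" | "\<forall>z. \<forall>\<^sub>F w in at z. poly q (wp w) \<noteq> 0"
    using meromorphic_imp_constant_or_avoid[of "\<lambda>w. poly q (wp w)" UNIV 0]
    by (auto simp: eventually_cosparse_open_eq)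
  then show ?thesis
  proof cases
    case 1
    have "filterlim wp at_infinity (at 0)"
      using wp_pole[OF zero_in_lattice] by (simp add: is_pole_def)
    then have "\<forall>\<^sub>F w in at 0. poly q (wp w) \<noteq> 0"
      using eventually_poly_neq_0_at_infinity[OF q] by (rule eventually_compose_filterlim[rotated])
    moreover from 1 have "\<forall>\<^sub>F w in at 0. poly q (wp w) = 0"
      by blast
    ultimately have "\<forall>\<^sub>F w in at (0::complex). False"
      by eventually_elim simp
    then show ?thesis
      by simp
  qed blast
qed

text \<open>The bridge to the sphere: functions agreeing on punctured neighbourhoods share limits
  and poles, so the sphere value of \<open>g\<close> is the limit of the quotient, computed
  separately on the lattice, at roots of the denominator and elsewhere.\<close>

lemma ratfun_wp_value:
  assumes g: "g nicely_meromorphic_on UNIV"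
    and eq: "\<And>z. \<forall>\<^sub>F w in at z. g w = poly p (wp w) / poly q (wp w)"
    and q: "q \<noteq> 0" and cop: "coprime p q"
  shows "(if is_pole g z then CP_inf else CP_fin (g z)) = ratfun_cp1 p q (weierstrass_p \<Lambda> z)"
proof -
  let ?r = "\<lambda>w. poly p (wp w) / poly q (wp w)"
  have finite_value: ?thesis if "ratfun_cp1 p q (weierstrass_p \<Lambda> z) = CP_fin l" "?r \<midarrow>z\<rightarrow> l" for l
  proof -
    have "g \<midarrow>z\<rightarrow> l"
      using that(2) eq[of z] by (simp add: tendsto_cong)
    then show ?thesis
      using nicely_meromorphic_tendsto[OF g, of z l] that(1) by simp
  qed
  have infinite_value: ?thesis if "ratfun_cp1 p q (weierstrass_p \<Lambda> z) = CP_inf" "is_pole ?r z"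
    using that is_pole_cong[OF eq[of z] refl] by simp
  show ?thesis
  proof (cases "z \<in> \<Lambda>")
    case True
    have inf: "filterlim wp at_infinity (at z)"
      using wp_pole[OF True] by (simp add: is_pole_def)
    show ?thesis
    \<comment> \<open>Here \<open>wp\<close> tends to infinity, so the degrees decide the limit,
      exactly as in \<open>ratfun_cp1\<close> at \<open>CP_inf\<close>.\<close>
    proof (cases "degree p > degree q")
      case deg: True
      then have "is_pole ?r z"
        unfolding is_pole_def
        by (intro filterlim_compose[OF filterlim_poly_divide_at_infinity inf] q)
      then show ?thesis
        using infinite_value True deg by (simp add: weierstrass_p_eq)
    next
      case deg: False
      then have "?r \<midarrow>z\<rightarrow> coeff p (degree q) / lead_coeff q"
        by (intro filterlim_compose[OF poly_divide_tendsto_at_infinity inf] q) simp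
      then show ?thesis
        using finite_value True deg by (simp add: weierstrass_p_eq)
    qed
  next
    case False
    have cont: "isCont (\<lambda>w. poly p' (wp w)) z" for p'
      using analytic_at_imp_isCont[OF wp_analytic[OF False]] by (intro continuous_intros)
    show ?thesis
    proof (cases "poly q (wp z) = 0")
      case zero: True
      have "poly p (wp z) \<noteq> 0"
      proof
        assume "poly p (wp z) = 0"
        with zero have "[:- wp z, 1:] dvd p" "[:- wp z, 1:] dvd q"
          by (simp_all add: poly_eq_0_iff_dvd)
        with cop have "is_unit [:- wp z, 1:]"
          by (rule coprime_common_divisor)
        then show False
          by (simp add: is_unit_iff_degree)
      qed
      moreover have "filterlim (\<lambda>w. poly q (wp w)) (at 0) (at z)"
        using isContD[OF cont[of q]] poly_wp_nonzero[OF q, of z] zero by (simp add: filterlim_at)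
      ultimately have "is_pole ?r z"
        by (intro is_pole_divide cont)
      then show ?thesis
        using infinite_value False zero by (simp add: weierstrass_p_eq)
    next
      case nz: False
      have "?r \<midarrow>z\<rightarrow> poly p (wp z) / poly q (wp z)"
        using nz by (intro tendsto_divide isContD cont)
      then show ?thesis
        using finite_value False nz by (simp add: weierstrass_p_eq)
    qed
  qed
qed

section \<open>Reduction to a compact period parallelogram and Liouville's theorem\<close>

definition cell :: "complex set" where
  "cell = (\<lambda>(a, b). of_real a * \<omega>1 + of_real b * \<omega>2) ` ({0..1} \<times> {0..1})"

lemma compact_cell: "compact cell"
  unfolding cell_def
  by (intro compact_continuous_image compact_Times compact_Icc)
    (auto intro!: continuous_intros simp: case_prod_beta)

lemma translate_into_cell: "\<exists>v\<in>\<Lambda>. z + v \<in> cell"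
proof -
  obtain a b where z: "z = of_real a * \<omega>1 + of_real b * \<omega>2"
    using coords_exist by blast
  define v where "v = of_int (- \<lfloor>a\<rfloor>) * \<omega>1 + of_int (- \<lfloor>b\<rfloor>) * \<omega>2"
  have "z + v = of_real (frac a) * \<omega>1 + of_real (frac b) * \<omega>2"
    unfolding z v_def frac_def by (simp add: algebra_simps)
  moreover have "(frac a, frac b) \<in> {0..1} \<times> {0..1}"
    using frac_lt_1[of a] frac_lt_1[of b] by (simp add: less_imp_le)
  ultimately have "z + v \<in> cell"
    unfolding cell_def by (force intro: image_eqI[of _ _ "(frac a, frac b)"])
  moreover have "v \<in> \<Lambda>"
    unfolding v_def period_lattice_def by blast
  ultimately show ?thesis
    by blast
qed

text \<open>Removing singularities gives an entire function whose values are all taken on the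
  compact cell, hence a bounded one. The conclusion concerns punctured neighbourhoods because
  \<open>G\<close> may differ from its limit at isolated points.\<close>

lemma periodic_without_poles_constant:
  assumes mero: "G meromorphic_on UNIV"
    and per: "\<And>z v. v \<in> \<Lambda> \<Longrightarrow> G (z + v) = G z"
    and lim: "\<And>z. \<exists>l. G \<midarrow>z\<rightarrow> l"
  shows "\<exists>c. \<forall>z. \<forall>\<^sub>F w in at z. G w = c"
proof -
  define H where "H = remove_sings G"
  have iso: "isolated_singularity_at G z" for z
    using mero by (auto intro: meromorphic_on_isolated_singularity meromorphic_on_subset)
  have H_per: "H (z + v) = H z" if "v \<in> \<Lambda>" for z v
  proof -
    have "(\<lambda>w. G (z + v + w)) = (\<lambda>w. G (z + w))"
      using per[OF that] by (metis add.assoc add.commute)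
    then show ?thesis
      unfolding H_def by (metis remove_sings_shift_0)
  qed
  have "H analytic_on {z}" for z
  proof -
    obtain l where "G \<midarrow>z\<rightarrow> l"
      using lim by blast
    then have "H \<midarrow>z\<rightarrow> l"
      unfolding H_def using iso by simp
    then show ?thesis
      using nicely_meromorphic_tendsto(1) nicely_meromorphic_on_imp_analytic_at
        remove_sings_nicely_meromorphic[OF mero] H_def by blast
  qed
  then have "H analytic_on UNIV"
    using analytic_on_analytic_at by blast
  then have hol: "H holomorphic_on UNIV"
    by (rule analytic_imp_holomorphic)
  have "range H \<subseteq> H ` cell"
    using H_per translate_into_cell by (metis image_eqI image_subsetI)
  moreover have "compact (H ` cell)"
    using hol compact_cell
    by (meson compact_continuous_image continuous_on_subset holomorphic_on_imp_continuous_on subset_UNIV)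
  ultimately have "bounded (range H)"
    using bounded_subset compact_imp_bounded by blast
  then obtain c where "\<And>z. H z = c"
    using Liouville_theorem[OF hol] by (auto simp: constant_on_def)
  then show ?thesis
    using eventually_remove_sings_eq_at[OF iso] unfolding H_def
    by (intro exI[of _ c]) (simp add: eq_commute)
qed


subsection \<open>Even elliptic functions\<close>

text \<open>Induction on half the bound for the pole order at 0; periodicity carries the result at 0
  to the other lattice points.\<close>

lemma polynomial_in_wp:
  assumes mero: "G meromorphic_on UNIV"
    and per: "\<And>z v. v \<in> \<Lambda> \<Longrightarrow> G (z + v) = G z"
    and even: "\<And>z. G (- z) = G z"
    and lim: "\<And>z. z \<notin> \<Lambda> \<Longrightarrow> \<exists>l. G \<midarrow>z\<rightarrow> l"
    and lim0: "(\<lambda>z. z ^ (2 * n) * G z) \<midarrow>0\<rightarrow> c"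
  shows "\<exists>p. \<forall>z. \<forall>\<^sub>F w in at z. G w = poly p (wp w)"
  using assms
proof (induction n arbitrary: G c)
  case (0 G c)
  have lim: "\<exists>l. G \<midarrow>z\<rightarrow> l" for z
  proof (cases "z \<in> \<Lambda>")
    case True
    have "G \<midarrow>0\<rightarrow> c"
      using "0.prems"(5) by simp
    then have "G \<midarrow>0 + z\<rightarrow> c"
      by (rule periodic_tendsto[rotated]) (use True "0.prems"(2) in auto)
    then show ?thesis
      by auto
  qed (rule "0.prems"(4))
  obtain d where d: "\<forall>z. \<forall>\<^sub>F w in at z. G w = d"
    using periodic_without_poles_constant[of G] lim "0.prems"(1,2) by auto
  show ?case
    by (rule exI[of _ "[:d:]"]) (simp add: d)
next
  case (Suc n G c)
  \<comment> \<open>As \<open>z\<^sup>2 * wp z\<close> tends to 1, subtracting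
    \<open>c * wp z ^ Suc n\<close> cancels the highest pole term, so that \<open>F\<close> below
    tends to 0.\<close>
  define H where "H z = G z - c * wp z ^ Suc n" for z
  have H_mero: "H meromorphic_on UNIV"
    unfolding H_def[abs_def] by (intro meromorphic_intros wp_meromorphic Suc.prems(1))
  have H_even: "H (- z) = H z" for z
    by (simp add: H_def wp_even Suc.prems(3))
  have H_lim: "\<exists>l. H \<midarrow>z\<rightarrow> l" if z: "z \<notin> \<Lambda>" for z
  proof -
    obtain l where "G \<midarrow>z\<rightarrow> l"
      using Suc.prems(4)[OF z] by blast
    then have "(\<lambda>w. G w - c * wp w ^ Suc n) \<midarrow>z\<rightarrow> l - c * wp z ^ Suc n"
      by (intro tendsto_intros wp_tendsto z)
    then show ?thesis
      unfolding H_def by blast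
  qed
  define F where "F z = z ^ (2 * Suc n) * H z" for z
  have F_eq: "F z = z ^ (2 * Suc n) * G z - c * (z\<^sup>2 * wp z) ^ Suc n" for z
    by (simp add: F_def H_def right_diff_distrib power_mult_distrib power_mult[symmetric] mult_ac
        del: power_Suc mult_Suc_right)
  have "(\<lambda>z. z ^ (2 * Suc n) * G z - c * (z\<^sup>2 * wp z) ^ Suc n) \<midarrow>0\<rightarrow> c - c * 1 ^ Suc n"
    by (intro tendsto_diff tendsto_mult tendsto_power tendsto_const Suc.prems(5) square_times_wp_tendsto)
  then have "F \<midarrow>0\<rightarrow> 0"
    by (simp add: F_eq[abs_def])
  moreover have "F meromorphic_on {0}"
    unfolding F_def[abs_def]
    by (intro meromorphic_intros meromorphic_on_subset[OF H_mero]) auto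
  moreover have "F (- z) = F z" for z
    by (simp add: F_def H_even)
  ultimately obtain l where "(\<lambda>z. F z / z\<^sup>2) \<midarrow>0\<rightarrow> l"
    using even_tendsto_0_imp_double_zero by blast
  \<comment> \<open>The double zero of \<open>F\<close> absorbs two powers of \<open>z\<close>,
    lowering the exponent from \<open>2 * Suc n\<close> to \<open>2 * n\<close>.\<close>
  moreover have "\<forall>\<^sub>F z in at 0. F z / z\<^sup>2 = z ^ (2 * n) * H z"
    by (auto simp: eventually_at_filter F_def power2_eq_square)
  ultimately have "(\<lambda>z. z ^ (2 * n) * H z) \<midarrow>0\<rightarrow> l"
    by (simp add: tendsto_cong)
  moreover have "v \<in> \<Lambda> \<Longrightarrow> H (z + v) = H z" for z v
    by (simp add: H_def wp_periodic Suc.prems(2))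
  ultimately obtain p where p: "\<forall>z. \<forall>\<^sub>F w in at z. H w = poly p (wp w)"
    using Suc.IH[OF H_mero _ H_even H_lim] by blast
  have "\<forall>\<^sub>F w in at z. G w = poly (p + monom c (Suc n)) (wp w)" for z
    using p[rule_format, of z] by eventually_elim (simp add: H_def poly_monom algebra_simps)
  then show ?case
    by blast
qed

text \<open>The quotient of \<open>wp z - wp a\<close> by \<open>z - a\<close> has a finite limit,
  so the power of \<open>z - a\<close> that clears the pole may be replaced by the same power of
  \<open>wp z - wp a\<close>.\<close>

lemma clear_pole_with_wp:
  assumes g: "g meromorphic_on UNIV" and a: "a \<notin> \<Lambda>"
  shows "\<exists>n l. (\<lambda>z. (wp z - wp a) ^ n * g z) \<midarrow>a\<rightarrow> l"
proof -
  obtain n l where nl: "(\<lambda>z. (z - a) ^ n * g z) \<midarrow>a\<rightarrow> l"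
    using meromorphic_clear_pole[of g a] g meromorphic_on_subset by blast
  have "wp field_differentiable at a"
    using wp_analytic[OF a] by (rule analytic_on_imp_differentiable_at) simp
  then have "(\<lambda>z. (wp z - wp a) / (z - a)) \<midarrow>a\<rightarrow> deriv wp a"
    using field_differentiable_derivI by (simp add: has_field_derivative_iff)
  then have "(\<lambda>z. ((wp z - wp a) / (z - a)) ^ n * ((z - a) ^ n * g z)) \<midarrow>a\<rightarrow> deriv wp a ^ n * l"
    by (intro tendsto_intros nl)
  moreover have "\<forall>\<^sub>F z in at a.
      ((wp z - wp a) / (z - a)) ^ n * ((z - a) ^ n * g z) = (wp z - wp a) ^ n * g z"
    by (auto simp: eventually_at_filter power_divide)
  ultimately show ?thesis
    by (auto simp: tendsto_cong)
qed

text \<open>Singularities cannot accumulate in the compact cell, so finitely many factors suffice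
  there; periodicity extends the result to the plane.\<close>

lemma clear_poles_with_wp:
  assumes g: "g meromorphic_on UNIV" and per: "\<And>z v. v \<in> \<Lambda> \<Longrightarrow> g (z + v) = g z"
  obtains q where "q \<noteq> 0" "\<And>z. z \<notin> \<Lambda> \<Longrightarrow> \<exists>l. (\<lambda>w. poly q (wp w) * g w) \<midarrow>z\<rightarrow> l"
proof -
  define A where "A = {a \<in> cell. \<not> g analytic_on {a}} - \<Lambda>"
  have "{w. \<not> g analytic_on {w}} sparse_in cell"
    by (rule meromorphic_on_imp_sparse_singularities, rule meromorphic_on_subset[OF g]) simp
  then have "finite (cell \<inter> {w. \<not> g analytic_on {w}})"
    using compact_cell by (intro sparse_in_compact_finite)
  then have fin: "finite A"
    by (rule rev_finite_subset) (auto simp: A_def)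
  have "\<forall>a\<in>-\<Lambda>. \<exists>n. \<exists>l. (\<lambda>z. (wp z - wp a) ^ n * g z) \<midarrow>a\<rightarrow> l"
    using clear_pole_with_wp[OF g] by blast
  from bchoice[OF this] obtain N where
    N: "\<forall>a\<in>-\<Lambda>. \<exists>l. (\<lambda>z. (wp z - wp a) ^ N a * g z) \<midarrow>a\<rightarrow> l"
    by blast
  \<comment> \<open>One factor for each singular point \<open>a\<close> of the cell off the lattice,
    with the exponent that clears the pole there.\<close>
  define q where "q = (\<Prod>a\<in>A. [:- wp a, 1:] ^ N a)"
  define G where "G z = poly q (wp z) * g z" for z
  have q: "q \<noteq> 0"
    unfolding q_def using fin by simp
  have lim_cell: "\<exists>l. G \<midarrow>z\<rightarrow> l" if z: "z \<in> cell" "z \<notin> \<Lambda>" for z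
  proof (cases "z \<in> A")
    case True
    obtain l where l: "(\<lambda>w. (wp w - wp z) ^ N z * g w) \<midarrow>z\<rightarrow> l"
      using N z by blast
    define r where "r = (\<Prod>a\<in>A - {z}. [:- wp a, 1:] ^ N a)"
    have "q = [:- wp z, 1:] ^ N z * r"
      unfolding q_def r_def by (rule prod.remove[OF fin True])
    then have "G = (\<lambda>w. poly r (wp w) * ((wp w - wp z) ^ N z * g w))"
      by (simp add: fun_eq_iff G_def poly_power)
    moreover have "(\<lambda>w. poly r (wp w) * ((wp w - wp z) ^ N z * g w)) \<midarrow>z\<rightarrow> poly r (wp z) * l"
      by (intro tendsto_mult l tendsto_poly wp_tendsto z)
    ultimately show ?thesis
      by blast
  next
    case False
    then have "g \<midarrow>z\<rightarrow> g z"
      using z by (intro isContD analytic_at_imp_isCont) (simp add: A_def)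
    then have "G \<midarrow>z\<rightarrow> poly q (wp z) * g z"
      unfolding G_def[abs_def] by (intro tendsto_mult tendsto_poly wp_tendsto z)
    then show ?thesis
      by blast
  qed
  have "\<exists>l. G \<midarrow>z\<rightarrow> l" if z: "z \<notin> \<Lambda>" for z
  proof -
    obtain v where v: "v \<in> \<Lambda>" "z + v \<in> cell"
      using translate_into_cell by blast
    then obtain l where "G \<midarrow>z + v\<rightarrow> l"
      using lim_cell z add_in_lattice_iff by blast
    then have "G \<midarrow>z + v + - v\<rightarrow> l"
      by (rule periodic_tendsto[rotated]) (auto simp: G_def per wp_periodic uminus_in_lattice v)
    then show ?thesis
      by auto
  qed
  then show ?thesis
    using that[OF q] unfolding G_def[abs_def] by blast
qed

lemma rational_in_wp:
  assumes g: "g meromorphic_on UNIV"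
    and per: "\<And>z v. v \<in> \<Lambda> \<Longrightarrow> g (z + v) = g z"
    and even: "\<And>z. g (- z) = g z"
  shows "\<exists>p q. q \<noteq> 0 \<and> coprime p q \<and>
    (\<forall>z. \<forall>\<^sub>F w in at z. g w = poly p (wp w) / poly q (wp w))"
proof -
  obtain q where q: "q \<noteq> 0" "\<And>z. z \<notin> \<Lambda> \<Longrightarrow> \<exists>l. (\<lambda>w. poly q (wp w) * g w) \<midarrow>z\<rightarrow> l"
    using clear_poles_with_wp[OF g per] by blast
  define G where "G z = poly q (wp z) * g z" for z
  have mero: "G meromorphic_on UNIV"
    unfolding G_def[abs_def] by (intro meromorphic_intros wp_meromorphic g)
  obtain n c where "(\<lambda>z. (z - 0) ^ n * G z) \<midarrow>0\<rightarrow> c"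
    using meromorphic_clear_pole[of G 0] meromorphic_on_subset[OF mero] by blast
  \<comment> \<open>\<open>polynomial_in_wp\<close> expects an even exponent, which another factor
    \<open>z ^ n\<close> supplies; the new limit is 0 when \<open>n > 0\<close>.\<close>
  then have "(\<lambda>z. z ^ n * ((z - 0) ^ n * G z)) \<midarrow>0\<rightarrow> 0 ^ n * c"
    by (intro tendsto_intros)
  then have "(\<lambda>z. z ^ (2 * n) * G z) \<midarrow>0\<rightarrow> 0 ^ n * c"
    by (simp add: mult_2 power_add mult.assoc)
  then have "\<exists>p. \<forall>z. \<forall>\<^sub>F w in at z. G w = poly p (wp w)"
    by (intro polynomial_in_wp[OF mero]) (auto simp: G_def[abs_def] wp_periodic per wp_even even q(2))
  then obtain p where p: "\<And>z. \<forall>\<^sub>F w in at z. G w = poly p (wp w)"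
    by blast
  have "gcd p q \<noteq> 0"
    using q(1) by simp
  then obtain p' q' where pq: "p = p' * gcd p q" "q = q' * gcd p q" "coprime p' q'"
    using gcd_coprime_exists by blast
  \<comment> \<open>Where \<open>q\<close> does not vanish at \<open>wp w\<close>, neither do its
    factors \<open>q'\<close> and \<open>gcd p q\<close>, so the common factor can be
    cancelled.\<close>
  have "\<forall>\<^sub>F w in at z. g w = poly p' (wp w) / poly q' (wp w)" for z
    using p[of z] poly_wp_nonzero[OF q(1), of z]
  proof eventually_elim
    case (elim w)
    have "poly p (wp w) = poly p' (wp w) * poly (gcd p q) (wp w)"
      "poly q (wp w) = poly q' (wp w) * poly (gcd p q) (wp w)"
      using pq(1,2) by (metis poly_mult)+
    with elim show ?case
      by (auto simp: G_def field_simps)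
  qed
  moreover have "q' \<noteq> 0"
    using pq(2) q(1) by auto
  ultimately show ?thesis
    using pq(3) by blast
qed

section \<open>Invariance under p2 and the passage to sphere-valued functions\<close>

lemma invariant_under_wallpaper_p2_iff:
  "invariant_under (wallpaper_p2 \<Lambda>) f \<longleftrightarrow>
     (\<forall>z. f (- z) = f z) \<and> (\<forall>z. \<forall>v\<in>\<Lambda>. f (z + v) = f z)"
proof (intro iffI conjI allI ballI)
  assume inv: "invariant_under (wallpaper_p2 \<Lambda>) f"
  show "f (- z) = f z" for z
  proof -
    have "uminus \<in> wallpaper_p2 \<Lambda>"
      unfolding wallpaper_p2_def by (intro generate.incl) simp
    then show ?thesis
      using inv unfolding invariant_under_def by blast
  qed
  show "f (z + v) = f z" if "v \<in> \<Lambda>" for z v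
  proof -
    have "(\<lambda>z. z + v) \<in> wallpaper_p2 \<Lambda>"
      unfolding wallpaper_p2_def using that by (intro generate.incl) auto
    from bspec[OF inv[unfolded invariant_under_def] this] show ?thesis
      by simp
  qed
next
  assume f: "(\<forall>z. f (- z) = f z) \<and> (\<forall>z. \<forall>v\<in>\<Lambda>. f (z + v) = f z)"
  have Bij: "Bij UNIV = {h :: complex \<Rightarrow> complex. bij h}"
    by (auto simp: Bij_def)
  have shift: "bij (\<lambda>z. z + v)" for v :: complex
    by (rule bij_betwI[of _ _ _ "\<lambda>z. z - v"]) auto
  have gen: "bij h \<and> (\<forall>z. f (h z) = f z)" if "h \<in> insert uminus {\<lambda>z. z + v |v. v \<in> \<Lambda>}" for h
    using that f shift by (auto simp: bij_uminus)
  \<comment> \<open>Bijectivity is carried through the induction so that inverse and product in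
    \<open>BijGroup UNIV\<close> can be read as inverse function and composition.\<close>
  have "bij h \<and> (\<forall>z. f (h z) = f z)" if "h \<in> wallpaper_p2 \<Lambda>" for h
    using that unfolding wallpaper_p2_def
  proof (induction rule: generate.induct)
    case one
    then show ?case
      by (simp add: BijGroup_def bij_id[unfolded id_def])
  next
    case (incl h)
    then show ?case
      by (rule gen)
  next
    case (inv h)
    then have "bij h" "\<And>z. f (h z) = f z"
      using gen by blast+
    moreover have "inv\<^bsub>BijGroup UNIV\<^esub> h = inv_into UNIV h"
      using \<open>bij h\<close> by (simp add: inv_BijGroup Bij restrict_def)
    ultimately show ?case
      by (metis bij_imp_bij_inv bij_inv_eq_iff)
  next
    case (eng h1 h2)
    then show ?case
      by (auto simp: BijGroup_def Bij compose_def intro: bij_comp[unfolded o_def])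
  qed
  then show "invariant_under (wallpaper_p2 \<Lambda>) f"
    by (simp add: invariant_under_def)
qed

lemma invariant_imp_rational_in_wp:
  assumes "meromorphic_to_cp1 f" and inv: "invariant_under (wallpaper_p2 \<Lambda>) f"
  shows "\<exists>R. rational_function R \<and> f = (\<lambda>z. R (weierstrass_p \<Lambda> z))"
proof -
  obtain g where g: "g nicely_meromorphic_on UNIV"
    and f: "f = (\<lambda>z. if is_pole g z then CP_inf else CP_fin (g z))"
    using assms(1) by (auto simp: meromorphic_to_cp1_def)
  \<comment> \<open>At poles a nicely meromorphic function has the default value 0, so equal sphere
    values force equal values of \<open>g\<close>, and the invariance of \<open>f\<close> passes to
    \<open>g\<close> at every point.\<close>
  have g_eq: "g z = g w" if "f z = f w" for z w
  proof (cases "is_pole g z")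
    case True
    then have "is_pole g w"
      using that by (auto simp: f split: if_splits)
    then show ?thesis
      using True g nicely_meromorphic_tendsto(1)[OF g] by (metis UNIV_I nicely_meromorphic_on_def)
  qed (use that in \<open>auto simp: f split: if_splits\<close>)
  have "\<exists>p q. q \<noteq> 0 \<and> coprime p q \<and>
      (\<forall>z. \<forall>\<^sub>F w in at z. g w = poly p (wp w) / poly q (wp w))"
  proof (rule rational_in_wp)
    show "g meromorphic_on UNIV"
      using g by (simp add: nicely_meromorphic_on_def)
    show "g (- z) = g z" "v \<in> \<Lambda> \<Longrightarrow> g (z + v) = g z" for z v
      using inv by (auto simp: invariant_under_wallpaper_p2_iff intro!: g_eq)
  qed
  then obtain p q where pq: "q \<noteq> 0" "coprime p q"
    and eq: "\<forall>\<^sub>F w in at z. g w = poly p (wp w) / poly q (wp w)" for z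
    by blast
  have "f = (\<lambda>z. ratfun_cp1 p q (weierstrass_p \<Lambda> z))"
    unfolding f using ratfun_wp_value[OF g eq pq] by blast
  then show ?thesis
    using pq by (auto simp: rational_function_def)
qed

text \<open>Removing the singularities of the quotient gives a nicely meromorphic representative,
  which \<open>ratfun_wp_value\<close> matches with \<open>f\<close>; invariance is inherited from
  \<open>wp\<close> and the symmetries of the lattice.\<close>

lemma rational_in_wp_invariant:
  assumes "rational_function R"
  defines "f \<equiv> \<lambda>z. R (weierstrass_p \<Lambda> z)"
  shows "meromorphic_to_cp1 f" "invariant_under (wallpaper_p2 \<Lambda>) f"
proof -
  obtain p q where pq: "q \<noteq> 0" "coprime p q" and R: "R = ratfun_cp1 p q"
    using assms by (auto simp: rational_function_def)
  define r where "r w = poly p (wp w) / poly q (wp w)" for w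
  have r: "r meromorphic_on UNIV"
    unfolding r_def[abs_def] by (intro meromorphic_intros wp_meromorphic)
  have nice: "remove_sings r nicely_meromorphic_on UNIV"
    using r by (rule remove_sings_nicely_meromorphic)
  have "\<forall>\<^sub>F w in at z. remove_sings r w = r w" for z
    using r by (intro eventually_remove_sings_eq_at)
      (auto intro: meromorphic_on_isolated_singularity meromorphic_on_subset)
  then have "f = (\<lambda>z. if is_pole (remove_sings r) z then CP_inf else CP_fin (remove_sings r z))"
    unfolding f_def R using ratfun_wp_value[OF nice _ pq] by (simp add: r_def)
  then show "meromorphic_to_cp1 f"
    using nice by (auto simp: meromorphic_to_cp1_def)
  show "invariant_under (wallpaper_p2 \<Lambda>) f"
    by (auto simp: invariant_under_wallpaper_p2_iff f_def weierstrass_p_eq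
        wp_even wp_periodic uminus_in_lattice_iff add_in_lattice_iff)
qed

end

theorem mainTheorem3:
  fixes \<omega>1 \<omega>2 :: complex and \<Lambda> :: "complex set"
  assumes "\<omega>1 \<noteq> 0" and "\<omega>2 \<noteq> 0" and "\<omega>1 / \<omega>2 \<notin> \<real>"
    and "\<Lambda> = period_lattice \<omega>1 \<omega>2"
  shows "{f. meromorphic_to_cp1 f \<and> invariant_under (wallpaper_p2 \<Lambda>) f} =
         {\<lambda>z. R (weierstrass_p \<Lambda> z) | R. rational_function R}"
proof -
  interpret plane_lattice \<omega>1 \<omega>2
    using assms by unfold_locales
  show ?thesis
    unfolding assms(4) using invariant_imp_rational_in_wp rational_in_wp_invariant by blast
qed

end
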